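(* For every positive integer $k$, every parallel extension and every restriction of a $k$-system is a $k$-system. However, for $k\ge2$, the contraction of a $k$-system is not necessarily a $k$-system (i.e. for every integer $k\geq 2$ there exist a $k$-system $\mathcal{F}=(S,\mathcal{I})$ and $I\in\mathcal{I}$ such that $\mathcal{F}/I$ is not a $k$-system).
   Context: An independence system $(S,\mathcal{I})$ is a finite set $S$ with a nonempty downward-closed family $\mathcal{I}\subseteq2^S$ of independent sets. A loop is an element $s$ with $\{s\}\notin\mathcal{I}$. A basis of $X\subseteq S$ is an inclusion-wise maximal independent subset of $X$. $k$-system: for every $X\subseteq S$ and every two bases $P,Q$ of $X$, $|P|\le k|Q|$. Parallel extension of $\mathcal{F}=(S,\mathcal{I})$ along a non-loop element $s\in S$: ground set $S_{\circ s}=(S\setminus\{s\})\cup\{s_1,s_2\}$ with new elements $s_1,s_2$; for $X\subseteq S_{\circ s}$ let $\pi_s(X)=X$ if $X\cap\{s_1,s_2\}=\emptyset$ and $\pi_s(X)=(X\setminus\{s_1,s_2\})\cup\{s\}$ otherwise; the independent sets are the $X\subseteq S_{\circ s}$ with $|X\cap\{s_1,s_2\}|\le1$ and $\pi_s(X)\in\mathcal{I}$. Restriction to $Y\subseteq S$: $(Y,\{X\subseteq Y:X\in\mathcal{I}\})$. Contraction of $I\in\mathcal{I}$: $\mathcal{F}/I=(S\setminus I,\{X\subseteq S\setminus I:X\cup I\in\mathcal{I}\})$. *)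

theory Defs
  imports Main
begin

type_synonym 'a set_system = "'a set \<times> 'a set set"

abbreviation ground :: "'a set_system \<Rightarrow> 'a set" where
  "ground F \<equiv> fst F"

abbreviation indep :: "'a set_system \<Rightarrow> 'a set set" where
  "indep F \<equiv> snd F"

definition independence_system :: "'a set_system \<Rightarrow> bool" where
  "independence_system F \<longleftrightarrow>
     finite (ground F) \<and> indep F \<subseteq> Pow (ground F) \<and> indep F \<noteq> {} \<and>
     (\<forall>X\<in>indep F. \<forall>Y. Y \<subseteq> X \<longrightarrow> Y \<in> indep F)"

definition is_loop :: "'a set_system \<Rightarrow> 'a \<Rightarrow> bool" where
  "is_loop F s \<longleftrightarrow> s \<in> ground F \<and> {s} \<notin> indep F"

definition is_basis :: "'a set_system \<Rightarrow> 'a set \<Rightarrow> 'a set \<Rightarrow> bool" where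
  "is_basis F X B \<longleftrightarrow>
     B \<in> indep F \<and> B \<subseteq> X \<and>
     (\<forall>C. C \<in> indep F \<and> C \<subseteq> X \<and> B \<subseteq> C \<longrightarrow> C = B)"

definition k_system :: "nat \<Rightarrow> 'a set_system \<Rightarrow> bool" where
  "k_system k F \<longleftrightarrow>
     independence_system F \<and>
     (\<forall>X P Q. X \<subseteq> ground F \<and> is_basis F X P \<and> is_basis F X Q
        \<longrightarrow> card P \<le> k * card Q)"

definition parallel_proj :: "'a \<Rightarrow> 'a \<Rightarrow> 'a \<Rightarrow> 'a set \<Rightarrow> 'a set" where
  "parallel_proj s s1 s2 X =
     (if X \<inter> {s1, s2} = {} then X else (X - {s1, s2}) \<union> {s})"

text \<open>Intended for a non-loop \<open>s\<close> of \<open>F\<close> and two distinct elements \<open>s1\<close>, \<open>s2\<close>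
  outside \<open>ground F\<close>; these conditions are hypotheses wherever the operation is used.\<close>

definition parallel_extension ::
    "'a set_system \<Rightarrow> 'a \<Rightarrow> 'a \<Rightarrow> 'a \<Rightarrow> 'a set_system" where
  "parallel_extension F s s1 s2 =
     ((ground F - {s}) \<union> {s1, s2},
      {X. X \<subseteq> (ground F - {s}) \<union> {s1, s2} \<and>
          card (X \<inter> {s1, s2}) \<le> 1 \<and> parallel_proj s s1 s2 X \<in> indep F})"

definition restriction :: "'a set_system \<Rightarrow> 'a set \<Rightarrow> 'a set_system" where
  "restriction F Y = (Y, {X. X \<subseteq> Y \<and> X \<in> indep F})"

definition contraction :: "'a set_system \<Rightarrow> 'a set \<Rightarrow> 'a set_system" where
  "contraction F I =
     (ground F - I, {X. X \<subseteq> ground F - I \<and> X \<union> I \<in> indep F})"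

text \<open>By the next lemma, a contraction by an independent set can only fail to be a
  \<open>k\<close>-system through the inequality between the sizes of bases.\<close>

lemma independence_system_contraction:
  assumes "independence_system F" "I \<in> indep F"
  shows "independence_system (contraction F I)"
  unfolding independence_system_def
proof (intro conjI ballI allI impI)
  show "finite (ground (contraction F I))"
    using assms(1) by (simp add: contraction_def independence_system_def)
  show "indep (contraction F I) \<subseteq> Pow (ground (contraction F I))"
    by (auto simp: contraction_def)
  have "{} \<in> indep (contraction F I)"
    using assms(2) by (simp add: contraction_def)
  then show "indep (contraction F I) \<noteq> {}" by blast
next
  fix X Y assume X: "X \<in> indep (contraction F I)" and YX: "Y \<subseteq> X"
  then have "X \<union> I \<in> indep F" "Y \<union> I \<subseteq> X \<union> I"
    by (auto simp: contraction_def)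
  then have "Y \<union> I \<in> indep F"
    using assms(1) unfolding independence_system_def by blast
  with X YX show "Y \<in> indep (contraction F I)"
    by (auto simp: contraction_def)
qed

end

theory Submission
  imports Defs
begin

text \<open>Projecting the copies of \<open>s\<close> back to \<open>s\<close> maps bases of \<open>X\<close> in the parallel extension to
  bases of the projection of \<open>X\<close> in \<open>F\<close> and preserves their sizes; bases in a restriction are bases
  in \<open>F\<close>.

  For contractions, take elements \<open>a\<close>, \<open>c\<close>, \<open>b\<^sub>1\<close>, \<dots>, \<open>b\<^bsub>k+1\<^esub>\<close> and the maximal independent sets
  \<open>{c, b\<^sub>1, \<dots>, b\<^bsub>k+1\<^esub>}\<close>, \<open>{a, c}\<close> and \<open>{a, b\<^sub>1}\<close>. Independent sets have at most \<open>k + 2 \<le> 2 k\<close>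
  elements, so only one-element bases matter, and these cause no violation. After contracting
  \<open>{c}\<close>, both \<open>{a}\<close> and \<open>{b\<^sub>1, \<dots>, b\<^bsub>k+1\<^esub>}\<close> are bases of the ground set.\<close>

text \<open>Maximality in the form that the counterexample uses: a one-element or empty basis leaves
  little room in \<open>X\<close>.\<close>

lemma is_basis_insertD:
  assumes "is_basis F X B" "x \<in> X" "insert x B \<in> indep F"
  shows "x \<in> B"
  using assms unfolding is_basis_def by blast

section \<open>Restrictions\<close>

lemma independence_system_restriction:
  assumes "independence_system F" "Y \<subseteq> ground F"
  shows "independence_system (restriction F Y)"
proof -
  have "{} \<in> indep F"
    using assms(1) unfolding independence_system_def by blast
  then show ?thesis
    using assms finite_subset[OF assms(2)]
    unfolding independence_system_def restriction_def by auto
qed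

lemma is_basis_restriction:
  assumes "X \<subseteq> Y"
  shows "is_basis (restriction F Y) X B \<longleftrightarrow> is_basis F X B"
proof -
  have "C \<in> indep (restriction F Y) \<and> C \<subseteq> X \<longleftrightarrow> C \<in> indep F \<and> C \<subseteq> X" for C
    using assms by (auto simp: restriction_def)
  then show ?thesis
    unfolding is_basis_def by blast
qed

lemma k_system_restriction:
  assumes "k_system k F" "Y \<subseteq> ground F"
  shows "k_system k (restriction F Y)"
proof -
  have "ground (restriction F Y) = Y"
    by (simp add: restriction_def)
  then show ?thesis
    using assms independence_system_restriction[of F Y] is_basis_restriction[of _ Y F]
    unfolding k_system_def by (metis subset_trans)
qed

section \<open>Parallel extensions\<close>

lemma parallel_proj_mono:
  assumes "X \<subseteq> Y"
  shows "parallel_proj s s1 s2 X \<subseteq> parallel_proj s s1 s2 Y"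
  using assms unfolding parallel_proj_def by auto

lemma independence_system_parallel_extension:
  assumes F: "independence_system F"
  shows "independence_system (parallel_extension F s s1 s2)"
  unfolding independence_system_def
proof (intro conjI ballI allI impI)
  show "finite (ground (parallel_extension F s s1 s2))"
    using F by (simp add: parallel_extension_def independence_system_def)
  show "indep (parallel_extension F s s1 s2) \<subseteq> Pow (ground (parallel_extension F s s1 s2))"
    by (auto simp: parallel_extension_def)
  have "{} \<in> indep F"
    using F unfolding independence_system_def by blast
  then have "{} \<in> indep (parallel_extension F s s1 s2)"
    by (simp add: parallel_extension_def parallel_proj_def)
  then show "indep (parallel_extension F s s1 s2) \<noteq> {}" by blast
next
  fix X Y assume X: "X \<in> indep (parallel_extension F s s1 s2)" and YX: "Y \<subseteq> X"
  have "card (Y \<inter> {s1, s2}) \<le> card (X \<inter> {s1, s2})"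
    using YX by (intro card_mono) auto
  moreover have "parallel_proj s s1 s2 Y \<in> indep F"
    using F X parallel_proj_mono[OF YX, of s s1 s2]
    unfolding independence_system_def parallel_extension_def by auto
  ultimately show "Y \<in> indep (parallel_extension F s s1 s2)"
    using X YX by (auto simp: parallel_extension_def)
qed

text \<open>Supplies the copy \<open>t\<close> that stands for \<open>s\<close> when sets are lifted
  from \<open>F\<close>: the copy in \<open>P\<close> if there is one, otherwise any copy in
  \<open>X\<close>.\<close>

lemma card_le_one_subset_singleton:
  assumes "card (P \<inter> {s1, s2}) \<le> 1" "P \<subseteq> X" "X \<inter> {s1, s2} \<noteq> {}"
  obtains t where "t \<in> X \<inter> {s1, s2}" "P \<inter> {s1, s2} \<subseteq> {t}"
proof (cases "P \<inter> {s1, s2} = {}")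
  case True
  then show ?thesis using assms(3) that by blast
next
  case False
  then obtain t where t: "t \<in> P \<inter> {s1, s2}" by blast
  have "\<forall>x\<in>P \<inter> {s1, s2}. \<forall>y\<in>P \<inter> {s1, s2}. x = y"
    using assms(1) by (subst card_le_Suc0_iff_eq[symmetric]) simp_all
  then have "P \<inter> {s1, s2} \<subseteq> {t}"
    using t by blast
  then show ?thesis using t assms(2) that by blast
qed

text \<open>At most one copy is exchanged for \<open>s\<close>, and \<open>s\<close> is new to
  \<open>P\<close>, so nothing collapses.\<close>

lemma card_parallel_proj:
  assumes "finite P" "s \<notin> P" "card (P \<inter> {s1, s2}) \<le> 1"
  shows "card (parallel_proj s s1 s2 P) = card P"
proof (cases "P \<inter> {s1, s2} = {}")
  case True
  then show ?thesis by (simp add: parallel_proj_def)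
next
  case False
  then obtain t where t: "P \<inter> {s1, s2} \<subseteq> {t}" "t \<in> P \<inter> {s1, s2}"
    using card_le_one_subset_singleton[OF assms(3) order_refl False] by blast
  then have "parallel_proj s s1 s2 P = insert s (P - {t})"
    unfolding parallel_proj_def by auto
  moreover have "card (insert s (P - {t})) = card P"
    using assms(1,2) t(2) card_Suc_Diff1[of P t] by simp
  ultimately show ?thesis by simp
qed

text \<open>Maximality is pulled back: an independent \<open>C\<close> between the two projections
  lifts to an independent set between \<open>P\<close> and \<open>X\<close>, which must be
  \<open>P\<close>, and projecting again gives \<open>C\<close>.\<close>

lemma is_basis_parallel_proj:
  assumes F: "independence_system F"
    and s12: "s1 \<notin> ground F" "s2 \<notin> ground F"
    and X: "X \<subseteq> ground (parallel_extension F s s1 s2)"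
    and P: "is_basis (parallel_extension F s s1 s2) X P"
    and s: "s \<in> ground F"
  shows "is_basis F (parallel_proj s s1 s2 X) (parallel_proj s s1 s2 P)"
  unfolding is_basis_def
proof (intro conjI allI impI)
  have PX: "P \<subseteq> X" and Pc: "card (P \<inter> {s1, s2}) \<le> 1"
    and Pi: "parallel_proj s s1 s2 P \<in> indep F"
    using P by (simp_all add: is_basis_def parallel_extension_def)
  show "parallel_proj s s1 s2 P \<in> indep F" by (fact Pi)
  show "parallel_proj s s1 s2 P \<subseteq> parallel_proj s s1 s2 X"
    by (rule parallel_proj_mono[OF PX])
  fix C
  assume C: "C \<in> indep F \<and> C \<subseteq> parallel_proj s s1 s2 X \<and> parallel_proj s s1 s2 P \<subseteq> C"
  have sX: "s \<notin> X" and ss: "s \<noteq> s1" "s \<noteq> s2"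
    using X s s12 by (auto simp: parallel_extension_def)
  have Cg: "C \<subseteq> ground F"
    using C F unfolding independence_system_def by auto
  then have C12: "C \<inter> {s1, s2} = {}" using s12 by auto
  show "C = parallel_proj s s1 s2 P"
  proof (cases "X \<inter> {s1, s2} = {}")
    case True
    then have PP: "parallel_proj s s1 s2 P = P" and XX: "parallel_proj s s1 s2 X = X"
      using PX by (auto simp: parallel_proj_def)
    \<comment> \<open>Without copies in \<open>X\<close>, the projection fixes every subset of
      \<open>X\<close>, so \<open>C\<close> is its own lift.\<close>
    have "C \<in> indep (parallel_extension F s s1 s2)"
      using C X C12 XX by (auto simp: parallel_extension_def parallel_proj_def)
    then show ?thesis
      using P C unfolding is_basis_def PP XX by blast
  next
    case False
    obtain t where t: "t \<in> X \<inter> {s1, s2}" and Pt: "P \<inter> {s1, s2} \<subseteq> {t}"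
      using card_le_one_subset_singleton[OF Pc PX False] by blast
    \<comment> \<open>The lift trades \<open>s\<close> for \<open>t\<close>. Since \<open>t\<close>
      is the only copy that \<open>P\<close> can contain, \<open>C'\<close> will contain
      \<open>P\<close>.\<close>
    define C' where "C' = (if s \<in> C then insert t (C - {s}) else C)"
    have proj: "parallel_proj s s1 s2 C' = C"
      using C12 t ss unfolding C'_def parallel_proj_def by auto
    have "C' \<inter> {s1, s2} \<subseteq> {t}"
      using C12 unfolding C'_def by auto
    then have "card (C' \<inter> {s1, s2}) \<le> 1"
      using card_mono[of "{t}"] by fastforce
    moreover have C'X: "C' \<subseteq> X"
      using C t unfolding C'_def parallel_proj_def by (auto split: if_splits)
    ultimately have "C' \<in> indep (parallel_extension F s s1 s2)"
      using X proj C by (auto simp: parallel_extension_def)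
    moreover have "P \<subseteq> C'"
    proof
      fix x assume x: "x \<in> P"
      show "x \<in> C'"
      proof (cases "x \<in> {s1, s2}")
        case True
        then have "x = t" "s \<in> parallel_proj s s1 s2 P"
          using x Pt by (auto simp: parallel_proj_def)
        then show ?thesis using C by (auto simp: C'_def)
      next
        case False
        then have "x \<in> parallel_proj s s1 s2 P"
          using x by (auto simp: parallel_proj_def)
        moreover have "x \<noteq> s" using x PX sX by auto
        ultimately show ?thesis using C by (auto simp: C'_def)
      qed
    qed
    ultimately have "C' = P"
      using P C'X unfolding is_basis_def by blast
    then show ?thesis using proj by simp
  qed
qed

lemma k_system_parallel_extension:
  assumes F: "k_system k F" and s: "s \<in> ground F"
    and s12: "s1 \<notin> ground F" "s2 \<notin> ground F"
  shows "k_system k (parallel_extension F s s1 s2)"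
  unfolding k_system_def
proof (intro conjI allI impI)
  have ind: "independence_system F"
    using F by (simp add: k_system_def)
  then show ext: "independence_system (parallel_extension F s s1 s2)"
    by (rule independence_system_parallel_extension)
  fix X P Q
  assume "X \<subseteq> ground (parallel_extension F s s1 s2) \<and>
    is_basis (parallel_extension F s s1 s2) X P \<and> is_basis (parallel_extension F s s1 s2) X Q"
  then have X: "X \<subseteq> ground (parallel_extension F s s1 s2)"
    and P: "is_basis (parallel_extension F s s1 s2) X P"
    and Q: "is_basis (parallel_extension F s s1 s2) X Q" by auto
  have card_eq: "card (parallel_proj s s1 s2 B) = card B"
    if "is_basis (parallel_extension F s s1 s2) X B" for B
  proof (rule card_parallel_proj)
    have BX: "B \<subseteq> X" using that by (simp add: is_basis_def)
    then show "finite B"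
      using X ext by (meson finite_subset independence_system_def)
    show "s \<notin> B"
      using BX X s s12 by (auto simp: parallel_extension_def)
    show "card (B \<inter> {s1, s2}) \<le> 1"
      using that by (simp add: is_basis_def parallel_extension_def)
  qed
  have "parallel_proj s s1 s2 X \<subseteq> ground F"
    using X s by (auto simp: parallel_extension_def parallel_proj_def)
  then have "card (parallel_proj s s1 s2 P) \<le> k * card (parallel_proj s s1 s2 Q)"
    using F is_basis_parallel_proj[OF ind s12 X P s] is_basis_parallel_proj[OF ind s12 X Q s]
    unfolding k_system_def by blast
  then show "card P \<le> k * card Q"
    using card_eq P Q by simp
qed

section \<open>Contractions\<close>

text \<open>Here \<open>a = 0\<close>, \<open>c = 1\<close> and \<open>b\<^sub>i = i + 1\<close>.\<close>

definition contraction_example :: "nat \<Rightarrow> nat set_system" where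
  "contraction_example k =
     ({0..k + 2}, {X. X \<subseteq> {1..k + 2} \<or> X \<subseteq> {0, 1} \<or> X \<subseteq> {0, 2}})"

lemma k_system_contraction_example:
  assumes k: "k \<ge> 2"
  shows "k_system k (contraction_example k)"
  unfolding k_system_def
proof (intro conjI allI impI)
  let ?F = "contraction_example k"
  show "independence_system ?F"
    unfolding independence_system_def contraction_example_def by auto
  fix X P Q
  assume "X \<subseteq> ground ?F \<and> is_basis ?F X P \<and> is_basis ?F X Q"
  then have X: "X \<subseteq> {0..k + 2}" and P: "is_basis ?F X P" and Q: "is_basis ?F X Q"
    by (auto simp: contraction_example_def)
  have PX: "P \<subseteq> X" and QX: "Q \<subseteq> X"
    and Pi: "P \<subseteq> {1..k + 2} \<or> P \<subseteq> {0, 1} \<or> P \<subseteq> {0, 2}"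
    using P Q by (auto simp: is_basis_def contraction_example_def)
  have small: "card A \<le> 2" if "A \<subseteq> {x, y}" for A and x y :: nat
  proof -
    have "card A \<le> card {x, y}" using that by (intro card_mono) simp_all
    also have "\<dots> \<le> 2" by (simp add: card_insert_if)
    finally show ?thesis .
  qed
  have finQ: "finite Q"
    using QX X by (meson finite_subset finite_atLeastAtMost)
  consider "card Q = 0" | "card Q = 1" | "card Q \<ge> 2" by linarith
  then show "card P \<le> k * card Q"
  proof cases
    case 1
    then have "Q = {}" using finQ by simp
    \<comment> \<open>All singletons are independent, so only the empty set has an empty
      basis.\<close>
    have "x \<notin> X" for x
    proof
      assume x: "x \<in> X"
      then have "insert x Q \<in> indep ?F"
        using X \<open>Q = {}\<close> by (auto simp: contraction_example_def)
      then show False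
        using is_basis_insertD[OF Q x] \<open>Q = {}\<close> by simp
    qed
    then have "P = {}" using PX by blast
    then show ?thesis by simp
  next
    case 2
    then obtain q where q: "Q = {q}" by (auto simp: card_1_singleton_iff)
    have "card P \<le> k"
    proof (cases "q = 0")
      case True
      \<comment> \<open>Both \<open>{0, 1}\<close> and \<open>{0, 2}\<close> are independent.
        Excluding 1 and 2 leaves only the \<open>k\<close> elements of \<open>{3..k + 2}\<close>
        besides 0; this is what the extra set \<open>{0, 2}\<close> is for.\<close>
      have "1 \<notin> X" "2 \<notin> X"
        using is_basis_insertD[OF Q, of 1] is_basis_insertD[OF Q, of 2] q True
        by (auto simp: contraction_example_def)
      \<comment> \<open>The singleton is written as \<open>{0, 0}\<close> to match the shape of
        \<open>small\<close>.\<close>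
      then have "P \<subseteq> {1..k + 2} - {1, 2} \<or> P \<subseteq> {0, 0}"
        using PX Pi by blast
      moreover have "{1..k + 2} - {1, 2} = {3..k + 2}" by auto
      ultimately have "P \<subseteq> {3..k + 2} \<or> P \<subseteq> {0, 0}" by simp
      then show ?thesis
        using card_mono[of "{3..k + 2}" P] small[of P 0 0] k by auto
    next
      case False
      \<comment> \<open>Any two nonzero elements are jointly independent, so \<open>{q}\<close>
        could be extended by any other nonzero element of \<open>X\<close>.\<close>
      have "X \<subseteq> {0, q}"
      proof
        fix x assume x: "x \<in> X"
        have "x \<in> Q" if "x \<noteq> 0"
        proof (rule is_basis_insertD[OF Q x])
          have "x \<le> k + 2" "q \<le> k + 2"
            using x q X QX by auto
          then show "insert x Q \<in> indep ?F"
            using that False q by (simp add: contraction_example_def)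
        qed
        then show "x \<in> {0, q}" using q by auto
      qed
      then have "card P \<le> 2" using PX small[of P 0 q] by blast
      then show ?thesis using k by simp
    qed
    then show ?thesis using 2 by simp
  next
    case 3
    have "card P \<le> k + 2"
      using Pi card_mono[of "{1..k + 2}" P] small[of P 0 1] small[of P 0 2] by auto
    also have "\<dots> \<le> k * 2" using k by simp
    also have "\<dots> \<le> k * card Q" using 3 by simp
    finally show ?thesis .
  qed
qed

lemma not_k_system_contraction_example:
  "\<not> k_system k (contraction (contraction_example k) {1})"
proof
  let ?G = "contraction (contraction_example k) {1}"
  assume G: "k_system k ?G"
  have g: "ground ?G = {0} \<union> {2..k + 2}"
    by (auto simp: contraction_def contraction_example_def)
  \<comment> \<open>The set \<open>{0, 2}\<close> leaves no trace here: with 1 added, it lies in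
    none of the three maximal sets. From \<open>{0, 1}\<close> only \<open>{0}\<close>
    survives.\<close>
  have i: "B \<in> indep ?G \<longleftrightarrow> B \<subseteq> {2..k + 2} \<or> B \<subseteq> {0}" for B
  proof -
    have "{0..k + 2} - {1} = insert 0 {2..k + 2}" "{1..k + 2} = insert 1 {2..k + 2}" by auto
    moreover have "0 \<notin> {2..k + 2}" "1 \<notin> {2..k + 2}" by auto
    ultimately show ?thesis
      by (simp add: contraction_def contraction_example_def) blast
  qed
  have "C = {2..k + 2}" if "C \<subseteq> {2..k + 2} \<or> C \<subseteq> {0}" "{2..k + 2} \<subseteq> C" for C
  proof -
    have "2 \<in> C" using that(2) by (rule subsetD) simp
    then have "\<not> C \<subseteq> {0}" by auto
    then show ?thesis using that by simp
  qed
  then have "is_basis ?G (ground ?G) {2..k + 2}"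
    unfolding is_basis_def i g by (intro conjI allI impI) auto
  moreover have "is_basis ?G (ground ?G) {0}"
    unfolding is_basis_def i g by auto
  \<comment> \<open>The left side is \<open>k + 1\<close>, the right side \<open>k\<close>.\<close>
  ultimately have "card {2..k + 2} \<le> k * card {0::nat}"
    using G unfolding k_system_def by blast
  then show False by simp
qed

theorem lemma10:
  shows "(\<forall>(k::nat) (F::'a set_system). k \<ge> 1 \<longrightarrow> k_system k F \<longrightarrow>
            (\<forall>s s1 s2. s \<in> ground F \<and> \<not> is_loop F s \<and>
                s1 \<notin> ground F \<and> s2 \<notin> ground F \<and> s1 \<noteq> s2 \<longrightarrow>
                k_system k (parallel_extension F s s1 s2)) \<and>
            (\<forall>Y. Y \<subseteq> ground F \<longrightarrow> k_system k (restriction F Y)))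
       \<and> (\<forall>k::nat. k \<ge> 2 \<longrightarrow>
            (\<exists>(F::nat set_system) I. k_system k F \<and> I \<in> indep F \<and>
                \<not> k_system k (contraction F I)))"
proof (intro conjI allI impI)
  fix k :: nat and F :: "'a set_system" and s s1 s2
  assume "k_system k F" "s \<in> ground F \<and> \<not> is_loop F s \<and>
    s1 \<notin> ground F \<and> s2 \<notin> ground F \<and> s1 \<noteq> s2"
  then show "k_system k (parallel_extension F s s1 s2)"
    by (blast intro: k_system_parallel_extension)
next
  fix k :: nat and F :: "'a set_system" and Y
  assume "k_system k F" "Y \<subseteq> ground F"
  then show "k_system k (restriction F Y)"
    by (rule k_system_restriction)
next
  fix k :: nat
  assume "k \<ge> 2"
  moreover have "{1} \<in> indep (contraction_example k)"
    by (simp add: contraction_example_def)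
  ultimately show "\<exists>(F::nat set_system) I. k_system k F \<and> I \<in> indep F \<and>
      \<not> k_system k (contraction F I)"
    using k_system_contraction_example not_k_system_contraction_example by blast
qed

end
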